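(* For every infinite cardinal $\kappa\le\mathfrak{c}$ there exists a family $\mathcal{T}_\kappa\subset\mathcal{L}$ with $|\mathcal{T}_\kappa|=2^\kappa$ such that for each $\tau\in\mathcal{T}_\kappa$ the space $(\mathbb{R},\tau)$ is a completely normal Baire space of weight $\kappa$, and for distinct $\tau,\tau'\in\mathcal{T}_\kappa$ the spaces $(\mathbb{R},\tau)$ and $(\mathbb{R},\tau')$ are not homeomorphic.
   Context: $\mathfrak{c}=|\mathbb{R}|$. $\eta$ denotes the Euclidean topology on $\mathbb{R}$. $\mathcal{L}$ denotes the family of all Hausdorff topologies $\tau$ on $\mathbb{R}$ with $\tau\subset\eta$. The weight of a space is the least cardinality of a base of its topology. *)

theory Defs
  imports "HOL-Analysis.Analysis"
begin

definition Baire_space :: "'a topology \<Rightarrow> bool" where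
  "Baire_space X \<longleftrightarrow>
     (\<forall>U :: nat \<Rightarrow> 'a set.
        (\<forall>n. openin X (U n) \<and> X closure_of (U n) = topspace X)
        \<longrightarrow> X closure_of (topspace X \<inter> (\<Inter>n. U n)) = topspace X)"

definition base_of :: "'a topology \<Rightarrow> 'a set set \<Rightarrow> bool" where
  "base_of X B \<longleftrightarrow> (\<forall>V\<in>B. openin X V) \<and>
     (\<forall>U x. openin X U \<and> x \<in> U \<longrightarrow> (\<exists>V\<in>B. x \<in> V \<and> V \<subseteq> U))"

definition has_weight :: "'a topology \<Rightarrow> 'b set \<Rightarrow> bool" where
  "has_weight X K \<longleftrightarrow>
     (\<exists>B. base_of X B \<and> (card_of B, card_of K) \<in> ordIso) \<and>
     (\<forall>B. base_of X B \<longrightarrow> (card_of K, card_of B) \<in> ordLeq)"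

definition L_family :: "real topology set" where
  "L_family = {\<tau>. topspace \<tau> = UNIV \<and> Hausdorff_space \<tau> \<and> (\<forall>U. openin \<tau> U \<longrightarrow> open U)}"

end

theory Submission
  imports Defs
begin

text \<open>Every topology used here is Euclidean away from the natural numbers. A neighbourhood of
  \<open>n \<ge> 1\<close> must also contain small intervals around almost all members of a sequence running to
  minus infinity (the sequences for different \<open>n\<close> are disjoint), and a neighbourhood of \<open>0\<close> must
  contain small intervals around all \<open>k + 1 / 2\<close> with \<open>k\<close> in some member of a free filter on the
  natural numbers. The filter is generated by the final segments and by the members indexed by
  \<open>X\<close> of an independent family of size continuum, hence has character equal to the
  cardinality of \<open>X\<close>, which becomes the weight. The sequences make every natural number
  topologically recognisable, so homeomorphisms preserve every interval \<open>(k, k + 1)\<close>;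
  thus the filter, and with it \<open>X\<close>, is determined by the homeomorphism type.\<close>

section \<open>An independent family of sets of natural numbers\<close>

text \<open>The second component of the decoded pair is ignored, so that every finite union of rational
  intervals occurs for infinitely many indices.\<close>

definition cov :: "nat \<Rightarrow> real set" where
  "cov n = (\<Union>(a, b) \<in> set (from_nat (fst (prod_decode n))). {real_of_rat a<..<real_of_rat b})"

text \<open>No finite intersection of the sets \<open>{k. x \<in> cov k}\<close> is almost contained
  in a further one; this is the form of independence used throughout. Each point of \<open>R\<close>
  gets a rational interval missing \<open>s\<close>.\<close>

lemma cov_independent:
  assumes "finite R" "s \<notin> R"
  shows "\<exists>k\<ge>m. R \<subseteq> cov k \<and> s \<notin> cov k"
proof -
  let ?U = "\<lambda>l. \<Union>(a, b) \<in> set l. {real_of_rat a<..<real_of_rat b}"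
  have "\<exists>l. R \<subseteq> ?U l \<and> s \<notin> ?U l"
    using assms
  proof (induction R)
    case empty
    show ?case by (rule exI[of _ "[]"]) simp
  next
    case (insert x R)
    then obtain l where l: "R \<subseteq> ?U l" "s \<notin> ?U l" by auto
    have "x \<noteq> s" using insert by auto
    obtain a b where ab: "real_of_rat a < x" "x < real_of_rat b"
        "\<not> (real_of_rat a < s \<and> s < real_of_rat b)"
    proof (cases "s < x")
      case True
      obtain a b where "s < real_of_rat a" "real_of_rat a < x" "x < real_of_rat b"
        using of_rat_dense[OF True] of_rat_dense[of x "x + 1"] by auto
      then show ?thesis using that[of a b] by auto
    next
      case False
      then have "x < s" using \<open>x \<noteq> s\<close> by simp
      obtain a b where "real_of_rat a < x" "x < real_of_rat b" "real_of_rat b < s"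
        using of_rat_dense[OF \<open>x < s\<close>] of_rat_dense[of "x - 1" x] by auto
      then show ?thesis using that[of a b] by auto
    qed
    show ?case
      by (rule exI[of _ "(a, b) # l"]) (use l ab in auto)
  qed
  then obtain l where l: "R \<subseteq> ?U l" "s \<notin> ?U l" by blast
  \<comment> \<open>The ignored component \<open>m\<close> pushes the index up to at least
    \<open>m\<close> without changing \<open>cov\<close>.\<close>
  show ?thesis
    by (rule exI[of _ "prod_encode (to_nat l, m)"])
      (use l in \<open>simp add: cov_def le_prod_encode_2\<close>)
qed

section \<open>Gluing points at infinity to the natural numbers\<close>

text \<open>Every centre used below is half an integer. Distinct ones are at least 1/2 apart, so
  open balls of radius up to 1/4 around them are disjoint.\<close>

lemma close_half_integers_eq:
  fixes x y :: real
  assumes "2 * x \<in> \<int>" "2 * y \<in> \<int>" "dist x y < 1 / 2"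
  shows "x = y"
proof (rule ccontr)
  assume "x \<noteq> y"
  obtain i j where ij: "2 * x = of_int i" "2 * y = of_int j"
    using assms by (auto elim!: Ints_cases)
  then have "i \<noteq> j" using \<open>x \<noteq> y\<close> by auto
  then have "\<bar>real_of_int i - real_of_int j\<bar> \<ge> 1" by linarith
  then show False using assms(3) ij unfolding dist_real_def by linarith
qed

lemma uncountable_open:
  fixes U :: "real set"
  assumes "open U" "U \<noteq> {}"
  shows "uncountable U"
proof -
  obtain x \<epsilon> where "\<epsilon> > 0" "ball x \<epsilon> \<subseteq> U"
    using assms open_contains_ball by blast
  then show ?thesis using countable_subset uncountable_ball by blast
qed

text \<open>Radii up to 1/8 leave gaps: a ball of radius 1/16 meets at most one of these sets, so
  the family is locally finite.\<close>

lemma closed_Union_cball_half_integers: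
  fixes Z :: "real set"
  assumes "\<And>z. z \<in> Z \<Longrightarrow> 2 * z \<in> \<int>" "\<And>z. z \<in> Z \<Longrightarrow> r z \<le> 1 / 8"
  shows "closed (\<Union>z\<in>Z. cball z (r z))"
proof -
  have "locally_finite_in euclidean ((\<lambda>z. cball z (r z)) ` Z)"
    unfolding locally_finite_in_def
  proof (intro conjI ballI)
    fix x :: real
    have "\<exists>w. {U \<in> (\<lambda>z. cball z (r z)) ` Z. U \<inter> ball x (1 / 16) \<noteq> {}} \<subseteq> {cball w (r w)}"
    proof (rule ccontr)
      assume contra: "\<not> ?thesis"
      have near: "dist x z < 1 / 4" if z: "z \<in> Z" and meets: "cball z (r z) \<inter> ball x (1 / 16) \<noteq> {}" for z
      proof -
        obtain y where "dist z y \<le> r z" "dist x y < 1 / 16" using meets by auto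
        with assms(2)[OF z] show ?thesis unfolding dist_real_def by linarith
      qed
      obtain z where z: "z \<in> Z" "cball z (r z) \<inter> ball x (1 / 16) \<noteq> {}" using contra by blast
      obtain w where w: "w \<in> Z" "cball w (r w) \<inter> ball x (1 / 16) \<noteq> {}" "w \<noteq> z"
        using contra by blast
      have "dist z w < 1 / 2"
        using near[OF z] near[OF w(1,2)] dist_triangle2[of z w x] by (simp add: dist_commute)
      then have "z = w" using close_half_integers_eq assms(1) z(1) w(1) by blast
      then show False using w(3) by simp
    qed
    then show "\<exists>V. openin euclidean V \<and> x \<in> V \<and>
        finite {U \<in> (\<lambda>z. cball z (r z)) ` Z. U \<inter> V \<noteq> {}}"
      by (intro exI[of _ "ball x (1 / 16)"]) (auto intro: finite_subset)
  qed auto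
  then show ?thesis
    using closedin_locally_finite_Union[of "(\<lambda>z. cball z (r z)) ` Z" euclidean] by auto
qed

text \<open>\<open>T n\<close> is meant as a filter base of sets of points attached to
  \<open>real n\<close>. One radius serves all of \<open>A\<close>, so that countably many radii
  suffice for a neighbourhood base.\<close>

definition glue :: "(nat \<Rightarrow> real set set) \<Rightarrow> real topology" where
  "glue T = topology (\<lambda>U. open U \<and>
     (\<forall>n. real n \<in> U \<longrightarrow> (\<exists>A\<in>T n. \<exists>\<epsilon>>0. \<forall>d\<in>A. ball d \<epsilon> \<subseteq> U)))"

definition halo :: "nat \<Rightarrow> real set \<Rightarrow> real \<Rightarrow> real set" where
  "halo n A \<epsilon> = (\<Union>d\<in>insert (real n) A. ball d \<epsilon>)"

text \<open>Half-integrality separates the centres, disjointness assigns each of them to one natural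
  number, directedness makes intersections open, freeness makes points closed, and nonempty traces
  destroy local connectedness at the naturals.\<close>

locale gluing =
  fixes T :: "nat \<Rightarrow> real set set"
  assumes T_nonempty: "T n \<noteq> {}"
    and T_half: "A \<in> T n \<Longrightarrow> d \<in> A \<Longrightarrow> 2 * d \<in> \<int> \<and> d \<notin> \<nat>"
    and T_disjoint: "A \<in> T m \<Longrightarrow> B \<in> T n \<Longrightarrow> m \<noteq> n \<Longrightarrow> A \<inter> B = {}"
    and T_directed: "A \<in> T n \<Longrightarrow> B \<in> T n \<Longrightarrow> \<exists>C\<in>T n. C \<subseteq> A \<inter> B"
    and T_free: "\<exists>A\<in>T n. d \<notin> A"
    and T_ne: "A \<in> T n \<Longrightarrow> A \<noteq> {}"
begin

lemma openin_glue:
  "openin (glue T) U \<longleftrightarrow> open U \<and>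
     (\<forall>n. real n \<in> U \<longrightarrow> (\<exists>A\<in>T n. \<exists>\<epsilon>>0. \<forall>d\<in>A. ball d \<epsilon> \<subseteq> U))"
proof -
  let ?P = "\<lambda>U. \<forall>n. real n \<in> U \<longrightarrow> (\<exists>A\<in>T n. \<exists>\<epsilon>>0. \<forall>d\<in>A. ball d \<epsilon> \<subseteq> U)"
  have "?P (S \<inter> S')" if S: "?P S" "?P S'" for S S'
  proof (intro allI impI)
    fix n assume n: "real n \<in> S \<inter> S'"
    obtain A \<epsilon> where A: "A \<in> T n" "\<epsilon> > 0" "\<forall>d\<in>A. ball d \<epsilon> \<subseteq> S" using S n by blast
    obtain B \<delta> where B: "B \<in> T n" "\<delta> > 0" "\<forall>d\<in>B. ball d \<delta> \<subseteq> S'" using S n by blast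
    obtain C where C: "C \<in> T n" "C \<subseteq> A \<inter> B" using T_directed A B by blast
    have "\<forall>d\<in>C. ball d (min \<epsilon> \<delta>) \<subseteq> S \<inter> S'"
      using A(3) B(3) C(2) by (auto simp: subset_iff)
    then show "\<exists>A\<in>T n. \<exists>\<epsilon>>0. \<forall>d\<in>A. ball d \<epsilon> \<subseteq> S \<inter> S'"
      using C(1) A(2) B(2) by (intro bexI[of _ C] exI[of _ "min \<epsilon> \<delta>"]) auto
  qed
  moreover have "?P (\<Union>\<K>)" if K: "\<forall>S\<in>\<K>. ?P S" for \<K>
  proof (intro allI impI)
    fix n assume "real n \<in> \<Union>\<K>"
    then obtain S where S: "S \<in> \<K>" "real n \<in> S" by blast
    then obtain A \<epsilon> where "A \<in> T n" "\<epsilon> > 0" "\<forall>d\<in>A. ball d \<epsilon> \<subseteq> S" using K by blast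
    then show "\<exists>A\<in>T n. \<exists>\<epsilon>>0. \<forall>d\<in>A. ball d \<epsilon> \<subseteq> \<Union>\<K>"
      using S by (meson Union_upper subset_trans)
  qed
  ultimately have "istopology (\<lambda>U. open U \<and> ?P U)"
    unfolding istopology_def by (auto intro!: open_Int open_Union)
  then show ?thesis by (simp add: glue_def)
qed

lemma openin_imp_open: "openin (glue T) U \<Longrightarrow> open U"
  by (simp add: openin_glue)

lemma openin_if_no_naturals: "open U \<Longrightarrow> U \<inter> \<nat> = {} \<Longrightarrow> openin (glue T) U"
  by (auto simp: openin_glue)

lemma topspace_glue [simp]: "topspace (glue T) = UNIV"
proof -
  have "openin (glue T) UNIV"
    using T_nonempty by (auto simp: openin_glue ex_in_conv intro: exI[of _ 1])
  then show ?thesis using openin_subset by blast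
qed

lemma core_half: "A \<in> T n \<Longrightarrow> d \<in> insert (real n) A \<Longrightarrow> 2 * d \<in> \<int>"
  using T_half by auto

text \<open>Traces avoid the naturals and those of different indices are disjoint, so a centre has a
  unique owner. This keeps the enlargements in the normality proof apart.\<close>

lemma core_owner:
  assumes "A \<in> T m" "B \<in> T n" "d \<in> insert (real m) A" "d \<in> insert (real n) B"
  shows "m = n"
proof (rule ccontr)
  assume "m \<noteq> n"
  then have "A \<inter> B = {}" using T_disjoint assms(1,2) by blast
  moreover have "real m \<notin> B" "real n \<notin> A" using T_half assms(1,2) of_nat_in_Nats by blast+
  ultimately show False using assms(3,4) \<open>m \<noteq> n\<close> by auto
qed

text \<open>A natural number this close to a centre coincides with it, and the only natural centre
  is \<open>real n\<close>.\<close>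

lemma halo_naturals:
  assumes "A \<in> T n" "\<epsilon> \<le> 1 / 2" "real m \<in> halo n A \<epsilon>"
  shows "m = n"
proof -
  obtain d where d: "d \<in> insert (real n) A" "dist d (real m) < \<epsilon>"
    using assms(3) by (auto simp: halo_def)
  then have "d = real m"
    using core_half[OF assms(1) d(1)] assms(2) by (intro close_half_integers_eq) auto
  then show ?thesis using d(1) T_half[OF assms(1), of d] by auto
qed

text \<open>By \<open>halo_naturals\<close> the gluing condition has to be checked only at
  \<open>n\<close>, where \<open>A\<close> and \<epsilon> serve.\<close>

lemma openin_halo:
  assumes "A \<in> T n" "0 < \<epsilon>" "\<epsilon> \<le> 1 / 2"
  shows "openin (glue T) (halo n A \<epsilon>)"
  unfolding openin_glue
proof (intro conjI allI impI)
  show "open (halo n A \<epsilon>)" by (auto simp: halo_def)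
  fix m assume "real m \<in> halo n A \<epsilon>"
  then have "m = n" using halo_naturals assms by blast
  moreover have "\<forall>d\<in>A. ball d \<epsilon> \<subseteq> halo n A \<epsilon>" by (auto simp: halo_def)
  ultimately show "\<exists>B\<in>T m. \<exists>\<delta>>0. \<forall>d\<in>B. ball d \<delta> \<subseteq> halo n A \<epsilon>"
    using assms by blast
qed

lemma halo_subset_open:
  assumes "openin (glue T) U" "real n \<in> U"
  obtains A \<epsilon> where "A \<in> T n" "0 < \<epsilon>" "\<epsilon> \<le> 1 / 4" "halo n A \<epsilon> \<subseteq> U"
proof -
  obtain A \<epsilon> where A: "A \<in> T n" "\<epsilon> > 0" "\<forall>d\<in>A. ball d \<epsilon> \<subseteq> U"
    using assms unfolding openin_glue by blast
  obtain \<delta> where d: "\<delta> > 0" "ball (real n) \<delta> \<subseteq> U"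
    using assms openin_imp_open open_contains_ball by blast
  have "halo n A (min (1 / 4) (min \<epsilon> \<delta>)) \<subseteq> U"
    using A(3) d(2) by (auto simp: halo_def subset_iff)
  then show ?thesis using that[of A "min (1 / 4) (min \<epsilon> \<delta>)"] A d by auto
qed

lemma in_halo: "0 < \<epsilon> \<Longrightarrow> real n \<in> halo n A \<epsilon>"
  by (simp add: halo_def)

lemma halo_mono: "\<epsilon> \<le> \<delta> \<Longrightarrow> A \<subseteq> B \<Longrightarrow> halo n A \<epsilon> \<subseteq> halo n B \<delta>"
  by (fastforce simp: halo_def)

section \<open>Separation axioms and the Baire property\<close>

text \<open>At most one half-integer lies within 1/4 of \<open>x\<close>; freeness supplies a trace
  avoiding it.\<close>

lemma T1_glue: "t1_space (glue T)"
proof -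
  have "openin (glue T) (- {x})" for x
    unfolding openin_glue
  proof (intro conjI allI impI)
    fix n
    show "\<exists>A\<in>T n. \<exists>\<epsilon>>0. \<forall>d\<in>A. ball d \<epsilon> \<subseteq> - {x}"
    proof (cases "\<exists>A\<in>T n. \<exists>d\<in>A. dist d x < 1 / 4")
      case True
      then obtain B d where d: "B \<in> T n" "d \<in> B" "dist d x < 1 / 4" by blast
      obtain A where A: "A \<in> T n" "d \<notin> A" using T_free by blast
      have "x \<notin> ball e (1 / 4)" if "e \<in> A" for e
      proof -
        have "e \<noteq> d" using that A by blast
        then have "\<not> dist e d < 1 / 2"
          using close_half_integers_eq[of e d] T_half[OF A(1) that] T_half[OF d(1,2)] by blast
        then show ?thesis using d(3) unfolding dist_real_def mem_ball by linarith
      qed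
      then show ?thesis using A(1) by (intro bexI[of _ A] exI[of _ "1 / 4"]) auto
    next
      case False
      then show ?thesis using T_nonempty[of n]
        by (metis Compl_iff equals0I mem_ball singletonD subsetI zero_less_divide_1_iff zero_less_numeral)
    qed
  qed auto
  then have "closedin (glue T) {x}" for x
    by (simp add: closedin_def Compl_eq_Diff_UNIV)
  then show ?thesis by (simp add: t1_space_closedin_singleton)
qed

lemma closure_le_closure_of: "closure S \<subseteq> glue T closure_of S"
proof (rule closure_minimal)
  show "closed (glue T closure_of S)"
    using openin_imp_open closedin_closure_of[of "glue T" S]
    by (metis Compl_eq_Diff_UNIV closed_def closedin_def topspace_glue)
qed (simp add: closure_of_subset)

text \<open>Two separated sets are first enlarged by closed halves of halos around their natural
  numbers. The enlarged sets are still separated in the Euclidean topology, and Euclidean open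
  sets separating them become open after removal of the superfluous natural numbers.\<close>

lemma hereditarily_normal_glue: "hereditarily normal_space (glue T)"
  unfolding hereditarily_normal_separation
proof (intro allI impI)
  fix S S' assume sep: "separatedin (glue T) S S'"
  have disj: "S \<inter> S' = {}" using separatedin_imp_disjoint[OF sep] by (simp add: disjnt_def)
  have choice: "\<exists>A \<epsilon>. \<forall>n. real n \<in> P \<longrightarrow>
      A n \<in> T n \<and> 0 < \<epsilon> n \<and> \<epsilon> n \<le> 1 / 4 \<and> halo n (A n) (\<epsilon> n) \<inter> Q = {}"
    if "separatedin (glue T) P Q" for P Q
  proof -
    have "\<exists>A \<epsilon>. real n \<in> P \<longrightarrow> A \<in> T n \<and> 0 < \<epsilon> \<and> \<epsilon> \<le> 1 / 4 \<and> halo n A \<epsilon> \<inter> Q = {}" for n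
    proof (cases "real n \<in> P")
      case True
      have "openin (glue T) (- (glue T closure_of Q))"
        by (metis Compl_eq_Diff_UNIV closedin_closure_of closedin_def topspace_glue)
      moreover have "real n \<in> - (glue T closure_of Q)"
        using that True by (auto simp: separatedin_def)
      ultimately obtain A \<epsilon> where "A \<in> T n" "0 < \<epsilon>" "\<epsilon> \<le> 1 / 4" "halo n A \<epsilon> \<subseteq> - (glue T closure_of Q)"
        by (rule halo_subset_open)
      moreover have "Q \<subseteq> glue T closure_of Q" by (simp add: closure_of_subset)
      ultimately show ?thesis by blast
    qed auto
    then show ?thesis by metis
  qed
  obtain A \<epsilon> where A: "\<And>n. real n \<in> S \<Longrightarrow>
      A n \<in> T n \<and> 0 < \<epsilon> n \<and> \<epsilon> n \<le> 1 / 4 \<and> halo n (A n) (\<epsilon> n) \<inter> S' = {}"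
    using choice[OF sep] by blast
  obtain A' \<epsilon>' where A': "\<And>n. real n \<in> S' \<Longrightarrow>
      A' n \<in> T n \<and> 0 < \<epsilon>' n \<and> \<epsilon>' n \<le> 1 / 4 \<and> halo n (A' n) (\<epsilon>' n) \<inter> S = {}"
    using choice[of S' S] sep separatedin_sym by blast
  define C where "C P A \<epsilon> = (\<Union>n\<in>{n. real n \<in> P}. \<Union>d\<in>insert (real n) (A n). cball d (\<epsilon> n / 2))"
    for P :: "real set" and A :: "nat \<Rightarrow> real set" and \<epsilon> :: "nat \<Rightarrow> real"
  have closed_C: "closed (C P A \<epsilon>)"
    if h: "\<And>n. real n \<in> P \<Longrightarrow> A n \<in> T n \<and> 0 < \<epsilon> n \<and> \<epsilon> n \<le> 1 / 4 \<and> halo n (A n) (\<epsilon> n) \<inter> Q = {}"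
    for P Q A \<epsilon>
  proof -
    let ?Z = "\<Union>n\<in>{n. real n \<in> P}. insert (real n) (A n)"
    have uniq: "m = n" if "real m \<in> P" "real n \<in> P" "d \<in> insert (real m) (A m)" "d \<in> insert (real n) (A n)" for m n d
      using core_owner[of "A m" m "A n" n d] h[OF that(1)] h[OF that(2)] that(3,4) by blast
    \<comment> \<open>Indexing the balls by their centres, via the unique owner, makes
      \<open>closed_Union_cball_half_integers\<close> applicable.\<close>
    define own where "own d = (THE n. real n \<in> P \<and> d \<in> insert (real n) (A n))" for d
    have own: "own d = n" if "real n \<in> P" "d \<in> insert (real n) (A n)" for n d
      unfolding own_def by (rule the_equality) (use that uniq in blast)+
    have "C P A \<epsilon> = (\<Union>z\<in>?Z. cball z (\<epsilon> (own z) / 2))"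
      unfolding C_def by (auto simp: own)
    also have "closed \<dots>"
    proof (rule closed_Union_cball_half_integers)
      fix z assume "z \<in> ?Z"
      then obtain n where n: "real n \<in> P" "z \<in> insert (real n) (A n)" by blast
      then show "2 * z \<in> \<int>" "\<epsilon> (own z) / 2 \<le> 1 / 8"
        using h[OF n(1)] core_half own[OF n] by auto
    qed
    finally show ?thesis .
  qed
  have C_open: "\<exists>W. open W \<and> C P A \<epsilon> \<subseteq> W \<and> W \<inter> Q = {}"
    if h: "\<And>n. real n \<in> P \<Longrightarrow> A n \<in> T n \<and> 0 < \<epsilon> n \<and> \<epsilon> n \<le> 1 / 4 \<and> halo n (A n) (\<epsilon> n) \<inter> Q = {}"
    for P Q A \<epsilon>
  proof (intro exI conjI)
    let ?W = "\<Union>n\<in>{n. real n \<in> P}. halo n (A n) (\<epsilon> n)"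
    show "open ?W" by (auto simp: halo_def)
    show "?W \<inter> Q = {}" using h by blast
    show "C P A \<epsilon> \<subseteq> ?W" unfolding C_def halo_def using h by fastforce
  qed
  \<comment> \<open>Two centres whose balls share a point are less than 1/2 apart, hence equal,
    hence owned by one natural number, which would lie in both \<open>S\<close> and
    \<open>S'\<close>.\<close>
  have C_disj: "C S A \<epsilon> \<inter> C S' A' \<epsilon>' = {}"
  proof (rule ccontr)
    assume "C S A \<epsilon> \<inter> C S' A' \<epsilon>' \<noteq> {}"
    then obtain x where "x \<in> C S A \<epsilon>" "x \<in> C S' A' \<epsilon>'" by blast
    then obtain m n d e where x: "real m \<in> S" "d \<in> insert (real m) (A m)" "dist d x \<le> \<epsilon> m / 2"
        "real n \<in> S'" "e \<in> insert (real n) (A' n)" "dist e x \<le> \<epsilon>' n / 2"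
      unfolding C_def UN_iff mem_cball mem_Collect_eq by blast
    have mn: "m \<noteq> n" using x disj by auto
    have "dist d e < 1 / 2"
      using x(3,6) A[OF x(1)] A'[OF x(4)] unfolding dist_real_def by linarith
    moreover have "2 * d \<in> \<int>" "2 * e \<in> \<int>"
      using core_half x(2,5) A[OF x(1)] A'[OF x(4)] by blast+
    ultimately have "d = e" using close_half_integers_eq by blast
    then show False
      using core_owner[of "A m" m "A' n" n d] x(2,5) mn A[OF x(1)] A'[OF x(4)] by blast
  qed
  let ?P = "S \<union> C S A \<epsilon>" and ?Q = "S' \<union> C S' A' \<epsilon>'"
  have cl: "closure S \<inter> S' = {}" "closure S' \<inter> S = {}"
    using sep closure_le_closure_of by (fastforce simp: separatedin_def)+
  \<comment> \<open>An open set missing \<open>S'\<close> also misses its Euclidean closure; this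
    keeps each enlargement away from the closure of the opposite set.\<close>
  obtain W where W: "open W" "C S A \<epsilon> \<subseteq> W" "W \<inter> S' = {}" using C_open[of S A \<epsilon> S'] A by blast
  obtain W' where W': "open W'" "C S' A' \<epsilon>' \<subseteq> W'" "W' \<inter> S = {}" using C_open[of S' A' \<epsilon>' S] A' by blast
  have "closure S \<inter> W' = {}" "closure S' \<inter> W = {}"
    using W W' by (metis Int_commute open_Int_closure_eq_empty)+
  moreover have "closure ?P = closure S \<union> C S A \<epsilon>" "closure ?Q = closure S' \<union> C S' A' \<epsilon>'"
    using closed_C[of S A \<epsilon> S'] closed_C[of S' A' \<epsilon>' S] A A' by (auto simp: closure_Un)
  ultimately have "separatedin euclidean ?P ?Q"
    unfolding separatedin_def using cl W W' C_disj by auto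
  moreover have "hereditarily normal_space (euclidean :: real topology)"
    by (intro metrizable_imp_hereditarily_normal_space metrizable_space_euclidean)
  ultimately obtain G H where G: "open G" "?P \<subseteq> G" and H: "open H" "?Q \<subseteq> H" and "disjnt G H"
    unfolding hereditarily_normal_separation by (metis open_openin)
  \<comment> \<open>Only naturals outside \<open>P\<close> are deleted. At a natural number
    \<open>n\<close> in \<open>P\<close> the half-size balls lie in the enlarged set and contain no
    natural number other than \<open>n\<close>.\<close>
  have restrict: "openin (glue T) (G - (\<nat> - P))"
    if h: "\<And>n. real n \<in> P \<Longrightarrow> A n \<in> T n \<and> 0 < \<epsilon> n \<and> \<epsilon> n \<le> 1 / 4 \<and> halo n (A n) (\<epsilon> n) \<inter> Q = {}"
      and "open G" "P \<union> C P A \<epsilon> \<subseteq> G" for P Q A \<epsilon> G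
    unfolding openin_glue
  proof (intro conjI allI impI)
    have "closed (\<nat> - P)"
      by (rule discrete_imp_closed[of 1]) (auto simp: dist_real_def elim!: Nats_cases)
    then show "open (G - (\<nat> - P))" using that(2) by (rule open_Diff[rotated])
    fix n assume "real n \<in> G - (\<nat> - P)"
    then have n: "real n \<in> P" by auto
    have "ball d (\<epsilon> n / 2) \<subseteq> G - (\<nat> - P)" if d: "d \<in> A n" for d
    proof
      fix y assume y: "y \<in> ball d (\<epsilon> n / 2)"
      then have "y \<in> C P A \<epsilon>" unfolding C_def using n d by force
      moreover have "y \<in> P" if "y \<in> \<nat>"
      proof -
        obtain m where m: "y = real m" using \<open>y \<in> \<nat>\<close> by (auto elim: Nats_cases)
        have "y \<in> halo n (A n) (1 / 2)" using y d h[OF n] by (force simp: halo_def)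
        then have "m = n" using halo_naturals[of "A n" n "1 / 2" m] h[OF n] m by auto
        then show ?thesis using n m by simp
      qed
      ultimately show "y \<in> G - (\<nat> - P)" using \<open>P \<union> C P A \<epsilon> \<subseteq> G\<close> by blast
    qed
    then show "\<exists>A\<in>T n. \<exists>\<epsilon>>0. \<forall>d\<in>A. ball d \<epsilon> \<subseteq> G - (\<nat> - P)"
      using h[OF n] by (intro bexI[of _ "A n"] exI[of _ "\<epsilon> n / 2"]) auto
  qed
  show "\<exists>U V. openin (glue T) U \<and> openin (glue T) V \<and> S \<subseteq> U \<and> S' \<subseteq> V \<and> disjnt U V"
  proof (intro exI conjI)
    show "openin (glue T) (G - (\<nat> - S))" "openin (glue T) (H - (\<nat> - S'))"
      using restrict[of S A \<epsilon> S' G] restrict[of S' A' \<epsilon>' S H] A A' G H by blast+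
  qed (use G H \<open>disjnt G H\<close> in \<open>auto simp: disjnt_def\<close>)
qed

lemma Hausdorff_glue: "Hausdorff_space (glue T)"
  by (simp add: T1_glue hereditarily_inc hereditarily_normal_glue normal_t1_imp_Hausdorff_space)

text \<open>Every nonempty Euclidean open set contains a nonempty open set missing the naturals, so
  dense open sets of \<open>glue T\<close> are Euclidean dense and open. The Baire theorem for the
  reals yields a dense intersection, and density passes to the coarser topology.\<close>

lemma Baire_glue: "Baire_space (glue T)"
  unfolding Baire_space_def
proof (intro allI impI)
  fix U :: "nat \<Rightarrow> real set"
  assume U: "\<forall>n. openin (glue T) (U n) \<and> glue T closure_of (U n) = topspace (glue T)"
  have "closure (U n) = UNIV" for n
  proof (rule ccontr)
    let ?W = "- closure (U n) - \<nat>"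
    assume "closure (U n) \<noteq> UNIV"
    then have "uncountable (- closure (U n))"
      using uncountable_open[of "- closure (U n)"] by blast
    moreover have "countable (\<nat> :: real set)" by (simp add: Nats_def)
    ultimately have "?W \<noteq> {}"
      by (metis Diff_eq_empty_iff countable_subset)
    have "open ?W" by (intro open_Diff) auto
    then have "openin (glue T) ?W" by (intro openin_if_no_naturals) auto
    then have "U n \<inter> ?W \<noteq> {}" using U \<open>?W \<noteq> {}\<close>
      by (metis Int_commute dense_intersects_open)
    then show False using closure_subset[of "U n"] by blast
  qed
  then have "UNIV \<subseteq> closure (\<Inter>(range U))"
  proof (intro Baire)
    fix V assume "V \<in> range U"
    then show "openin (top_of_set UNIV) V \<and> UNIV \<subseteq> closure V"
      using U openin_imp_open \<open>\<And>n. closure (U n) = UNIV\<close> by auto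
  qed auto
  then show "glue T closure_of (topspace (glue T) \<inter> (\<Inter>n. U n)) = topspace (glue T)"
    using closure_le_closure_of[of "\<Inter>n. U n"] by (metis Int_UNIV_left subset_UNIV subset_antisym subset_trans topspace_glue)
qed

section \<open>Connected and compact sets compared with the Euclidean ones\<close>

lemma continuous_map_id_glue: "continuous_map euclidean (glue T) id"
  by (simp add: continuous_map_def openin_imp_open)

lemma connectedin_if_connected: "connected C \<Longrightarrow> connectedin (glue T) C"
  using connectedin_continuous_map_image[OF continuous_map_id_glue, of C] by simp

text \<open>Off the naturals both topologies induce the same subspace topology, so a Euclidean
  separation of \<open>C\<close> survives deletion of the naturals.\<close>

lemma connected_if_connectedin:
  assumes "connectedin (glue T) C" "C \<inter> \<nat> = {}"
  shows "connected C"
  unfolding connected_def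
proof (rule notI, elim exE conjE)
  fix U V assume UV: "open U" "open V" "C \<subseteq> U \<union> V" "U \<inter> V \<inter> C = {}" "U \<inter> C \<noteq> {}" "V \<inter> C \<noteq> {}"
  have "openin (glue T) (U - \<nat>)" "openin (glue T) (V - \<nat>)"
    using UV by (auto intro!: openin_if_no_naturals open_Diff)
  moreover have "C \<subseteq> (U - \<nat>) \<union> (V - \<nat>)" "(U - \<nat>) \<inter> (V - \<nat>) \<inter> C = {}"
      "(U - \<nat>) \<inter> C \<noteq> {}" "(V - \<nat>) \<inter> C \<noteq> {}"
    using UV assms(2) by blast+
  ultimately show False using assms(1) unfolding connectedin by meson
qed

lemma closedin_if_compact:
  assumes "compact S"
  shows "closedin (glue T) S"
proof -
  have "compactin (glue T) (id ` S)"
    using assms by (intro image_compactin[OF _ continuous_map_id_glue]) auto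
  then show ?thesis using Hausdorff_glue compactin_imp_closedin by auto
qed

end

section \<open>Local connectedness detects the naturals\<close>

definition locally_connected_at :: "'a topology \<Rightarrow> 'a \<Rightarrow> bool" where
  "locally_connected_at X x \<longleftrightarrow> (\<forall>U. openin X U \<and> x \<in> U \<longrightarrow>
     (\<exists>W. openin X W \<and> connectedin X W \<and> x \<in> W \<and> W \<subseteq> U))"

lemma locally_connected_at_homeomorphic_maps:
  assumes "homeomorphic_maps X Y f g" "x \<in> topspace X" "locally_connected_at X x"
  shows "locally_connected_at Y (f x)"
  unfolding locally_connected_at_def
proof (intro allI impI)
  fix U assume U: "openin Y U \<and> f x \<in> U"
  have f: "homeomorphic_map X Y f" and g: "homeomorphic_map Y X g"
    using assms(1) homeomorphic_maps_map by auto
  have gf: "g (f y) = y" if "y \<in> topspace X" for y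
    using assms(1) that by (auto simp: homeomorphic_maps_def)
  have fg: "f (g y) = y" if "y \<in> topspace Y" for y
    using assms(1) that by (auto simp: homeomorphic_maps_def)
  have "openin X (g ` U)"
    using U g homeomorphic_map_openness_eq by blast
  moreover have "x \<in> g ` U" using U gf[OF assms(2)] by (metis imageI)
  ultimately obtain W where W: "openin X W" "connectedin X W" "x \<in> W" "W \<subseteq> g ` U"
    using assms(3) unfolding locally_connected_at_def by meson
  have "openin Y (f ` W)" using W(1) f homeomorphic_map_openness_eq by blast
  moreover have "connectedin Y (f ` W)"
    using W(2) f by (meson connectedin_continuous_map_image homeomorphic_imp_continuous_map)
  moreover have "f ` W \<subseteq> U"
    using W(4) fg openin_subset[of Y U] U by fastforce
  ultimately show "\<exists>W. openin Y W \<and> connectedin Y W \<and> f x \<in> W \<and> W \<subseteq> U"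
    using W(3) by blast
qed

context gluing
begin

text \<open>Away from the naturals small intervals are connected neighbourhoods. A connected
  neighbourhood of \<open>n\<close> inside a halo of radius 1/4 would contain an attached point
  whose ball can be split off.\<close>

lemma locally_connected_at_glue: "locally_connected_at (glue T) x \<longleftrightarrow> x \<notin> \<nat>"
proof
  assume x: "x \<notin> \<nat>"
  show "locally_connected_at (glue T) x"
    unfolding locally_connected_at_def
  proof (intro allI impI)
    fix U assume U: "openin (glue T) U \<and> x \<in> U"
    then have "open (U - \<nat>)" by (intro open_Diff openin_imp_open) auto
    then obtain \<epsilon> where e: "\<epsilon> > 0" "ball x \<epsilon> \<subseteq> U - \<nat>"
      using U x open_contains_ball by blast
    then have "openin (glue T) (ball x \<epsilon>)" by (intro openin_if_no_naturals) auto
    moreover have "connectedin (glue T) (ball x \<epsilon>)" by (simp add: connectedin_if_connected)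
    ultimately show "\<exists>W. openin (glue T) W \<and> connectedin (glue T) W \<and> x \<in> W \<and> W \<subseteq> U"
      using e by (intro exI[of _ "ball x \<epsilon>"]) auto
  qed
next
  assume lc: "locally_connected_at (glue T) x"
  show "x \<notin> \<nat>"
  proof
    assume "x \<in> \<nat>"
    then obtain n where n: "x = real n" by (auto elim: Nats_cases)
    obtain A where A: "A \<in> T n" using T_nonempty by blast
    have "openin (glue T) (halo n A (1 / 4))" using A by (intro openin_halo) auto
    then obtain W where W: "openin (glue T) W" "connectedin (glue T) W" "x \<in> W" "W \<subseteq> halo n A (1 / 4)"
      using lc in_halo[of "1 / 4" n A] n unfolding locally_connected_at_def by force
    obtain B \<epsilon> where B: "B \<in> T n" "0 < \<epsilon>" "halo n B \<epsilon> \<subseteq> W"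
      using halo_subset_open[OF W(1)] W(3) n by metis
    \<comment> \<open>Points of a trace inside \<open>A \<inter> B\<close> lie in \<open>W\<close>
      and are also centres of the surrounding halo.\<close>
    obtain C where C: "C \<in> T n" "C \<subseteq> A \<inter> B" using T_directed A B by blast
    obtain d where d: "d \<in> C" using T_ne C by blast
    obtain D where D: "D \<in> T n" "d \<notin> D" using T_free by blast
    let ?A' = "insert (real n) (A - {d})"
    let ?V = "\<Union>e\<in>?A'. ball e (1 / 4)"
    have dA: "d \<in> A" using d C by blast
    have d': "2 * d \<in> \<int>" "d \<notin> \<nat>" using T_half[OF A dA] by auto
    have far: "\<not> dist e d < 1 / 2" if "e \<in> ?A'" for e
      using close_half_integers_eq[of e d] core_half[OF A, of e] d' that by auto
    \<comment> \<open>Since \<open>E\<close> omits \<open>d\<close>, the remaining balls still form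
      a neighbourhood of \<open>real n\<close>.\<close>
    obtain E where E: "E \<in> T n" "E \<subseteq> A \<inter> D" using T_directed A D by blast
    have "openin (glue T) ?V"
      unfolding openin_glue
    proof (intro conjI allI impI)
      show "open ?V" by auto
      fix m assume "real m \<in> ?V"
      then have "real m \<in> halo n A (1 / 4)" by (auto simp: halo_def)
      then have "m = n" using halo_naturals[OF A, of "1 / 4" m] by simp
      moreover have "\<forall>e\<in>E. ball e (1 / 4) \<subseteq> ?V" using E D by blast
      ultimately show "\<exists>F\<in>T m. \<exists>\<epsilon>>0. \<forall>e\<in>F. ball e \<epsilon> \<subseteq> ?V"
        using E(1) by (intro bexI[of _ E] exI[of _ "1 / 4"]) auto
    qed
    moreover have "openin (glue T) (ball d (1 / 4))"
    proof (rule openin_if_no_naturals)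
      have "False" if "real m \<in> ball d (1 / 4)" for m
        using close_half_integers_eq[of d "real m"] d' that by auto
      then show "ball d (1 / 4) \<inter> \<nat> = {}" by (auto elim!: Nats_cases)
    qed simp
    moreover have "W \<subseteq> ball d (1 / 4) \<union> ?V" using W(4) by (auto simp: halo_def)
    moreover have "ball d (1 / 4) \<inter> ?V = {}"
    proof -
      have False if "e \<in> ?A'" "y \<in> ball d (1 / 4)" "y \<in> ball e (1 / 4)" for e y
        using that(2,3) far[OF that(1)] unfolding mem_ball dist_real_def by linarith
      then show ?thesis by blast
    qed
    moreover have "d \<in> halo n B \<epsilon>" using B(2) d C(2) by (force simp: halo_def)
    then have "d \<in> W" "real n \<in> W" using B(3) W(3) n by auto
    moreover have "d \<in> ball d (1 / 4)" "real n \<in> ?V" by auto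
    ultimately show False using W(2) unfolding connectedin by blast
  qed
qed

end

section \<open>The topology attached to a set of reals\<close>

text \<open>The point \<open>k + 1 / 2\<close> stands for \<open>k\<close>, so the combs with finite
  \<open>R \<subseteq> X\<close> encode a base of the filter attached to \<open>0\<close>.\<close>

definition comb :: "nat \<Rightarrow> real set \<Rightarrow> real set" where
  "comb m R = {real k + 1 / 2 | k. m \<le> k \<and> R \<subseteq> cov k}"

text \<open>Injectivity of \<open>prod_encode\<close> makes the tails of different \<open>n\<close>
  disjoint; \<open>Suc\<close> keeps them strictly negative.\<close>

definition tail :: "nat \<Rightarrow> nat \<Rightarrow> real set" where
  "tail n m = {- real (Suc (prod_encode (n, j))) | j. m \<le> j}"

definition traces :: "real set \<Rightarrow> nat \<Rightarrow> real set set" where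
  "traces X n = (if n = 0 then {comb m R | m R. finite R \<and> R \<subseteq> X} else range (tail n))"

abbreviation line :: "real set \<Rightarrow> real topology" where
  "line X \<equiv> glue (traces X)"

lemma comb_in_traces: "finite R \<Longrightarrow> R \<subseteq> X \<Longrightarrow> comb m R \<in> traces X 0"
  by (auto simp: traces_def)

lemma comb_positive:
  assumes "d \<in> comb m R"
  shows "2 * d \<in> \<int> \<and> d \<notin> \<nat> \<and> d > 0"
proof -
  obtain k where k: "d = real k + 1 / 2" using assms by (auto simp: comb_def)
  have "2 * d = of_nat (2 * k + 1)" by (simp add: k)
  then have "2 * d \<in> \<int>" by (metis Ints_of_nat)
  moreover have "real k + 1 / 2 \<noteq> real n" for n
  proof
    assume "real k + 1 / 2 = real n"
    then have "real (2 * k + 1) = real (2 * n)" by simp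
    then have "2 * k + 1 = 2 * n" using of_nat_eq_iff by blast
    then show False by presburger
  qed
  ultimately show ?thesis by (auto simp: k elim!: Nats_cases)
qed

lemma tail_negative:
  assumes "d \<in> tail n m"
  shows "2 * d \<in> \<int> \<and> d \<notin> \<nat> \<and> d < 0"
proof -
  obtain j where d: "d = - real (Suc j)" using assms by (auto simp: tail_def)
  have "2 * d = of_int (- 2 * int (Suc j))" by (simp add: d)
  then have "2 * d \<in> \<int>" by (metis Ints_of_int)
  then show ?thesis by (auto simp: d elim!: Nats_cases)
qed

interpretation line: gluing "traces X" for X
proof
  fix n m :: nat and A B :: "real set" and d :: real
  show "traces X n \<noteq> {}" by (auto simp: traces_def)
  show "2 * d \<in> \<int> \<and> d \<notin> \<nat>" if "A \<in> traces X n" "d \<in> A"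
    using that comb_positive tail_negative unfolding traces_def by (auto split: if_splits)
  show "A \<inter> B = {}" if "A \<in> traces X m" "B \<in> traces X n" "m \<noteq> n"
  proof -
    have "tail m i \<inter> tail n j = {}" for i j using that(3) by (auto simp: tail_def)
    moreover have "comb i R \<inter> tail n j = {}" "tail n j \<inter> comb i R = {}" for i j n R
      using comb_positive tail_negative by fastforce+
    ultimately show ?thesis
      using that unfolding traces_def disjoint_iff by (auto split: if_splits)
  qed
  show "\<exists>C\<in>traces X n. C \<subseteq> A \<inter> B" if AB: "A \<in> traces X n" "B \<in> traces X n"
  proof (cases "n = 0")
    case True
    obtain i Q where "A = comb i Q" "finite Q" "Q \<subseteq> X" using AB(1) True by (auto simp: traces_def)
    moreover obtain j R where "B = comb j R" "finite R" "R \<subseteq> X" using AB(2) True by (auto simp: traces_def)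
    moreover from calculation have "comb (max i j) (Q \<union> R) \<in> traces X 0"
      by (intro comb_in_traces) auto
    moreover have "comb (max i j) (Q \<union> R) \<subseteq> comb i Q \<inter> comb j R" by (auto simp: comb_def)
    ultimately show ?thesis using True by blast
  next
    case False
    then obtain i j where "A = tail n i" "B = tail n j" using AB by (auto simp: traces_def)
    moreover have "tail n (max i j) \<in> traces X n" using False by (simp add: traces_def)
    moreover have "tail n (max i j) \<subseteq> tail n i \<inter> tail n j" by (auto simp: tail_def)
    ultimately show ?thesis by blast
  qed
  show "\<exists>A\<in>traces X n. d \<notin> A"
  proof -
    \<comment> \<open>From index \<open>m\<close> on, both combs and tails lie beyond
      \<open>d\<close>.\<close>
    obtain m :: nat where m: "\<bar>d\<bar> < real m" using reals_Archimedean2 by blast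
    show ?thesis
    proof (cases "n = 0")
      case True
      have "d \<notin> comb m {}" using m by (auto simp: comb_def)
      then show ?thesis using comb_in_traces[of "{}" X m] True by auto
    next
      case False
      have "d \<notin> tail n m"
      proof
        assume "d \<in> tail n m"
        then obtain j where j: "d = - real (Suc (prod_encode (n, j)))" "m \<le> j" by (auto simp: tail_def)
        have "real m \<le> real (Suc (prod_encode (n, j)))"
          using le_prod_encode_2[of j n] j(2) by linarith
        then show False using m j(1) by linarith
      qed
      then show ?thesis using False by (auto simp: traces_def)
    qed
  qed
  show "A \<noteq> {}" if A: "A \<in> traces X n"
  proof (cases "n = 0")
    case True
    then obtain m R where mR: "A = comb m R" "finite R" using A by (auto simp: traces_def)
    obtain s where "s \<notin> R" using mR(2) by (metis ex_new_if_finite infinite_UNIV_char_0)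
    then obtain k where "k \<ge> m" "R \<subseteq> cov k" using cov_independent mR(2) by blast
    then show ?thesis by (auto simp: mR comb_def)
  next
    case False
    then show ?thesis using A by (auto simp: traces_def tail_def)
  qed
qed

lemma line_in_L_family: "line X \<in> L_family"
  using line.Hausdorff_glue line.openin_imp_open by (simp add: L_family_def)

section \<open>The path formed by the naturals and its rigidity\<close>

definition edge :: "nat \<Rightarrow> real set" where
  "edge n = {real n<..<real (Suc n)}"

lemma edge_naturals: "edge n \<inter> \<nat> = {}"
  by (auto simp: edge_def elim!: Nats_cases)

lemma connected_avoiding_naturals:
  assumes "connected C" "C \<inter> \<nat> = {}"
  shows "C \<subseteq> {..<0} \<or> (\<exists>n. C \<subseteq> edge n)"
proof (rule disjCI)
  assume "\<not> (\<exists>n. C \<subseteq> edge n)"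
  have avoid: "\<not> (x < real n \<and> real n < y)" if "x \<in> C" "y \<in> C" for x y n
    using connectedD_interval[OF assms(1) that, of "real n"] assms(2) by auto
  show "C \<subseteq> {..<0}"
  proof (rule ccontr)
    assume "\<not> C \<subseteq> {..<0}"
    then obtain x where x: "x \<in> C" "x \<ge> 0" by force
    define n where "n = nat \<lfloor>x\<rfloor>"
    have n: "real n \<le> x" "x < real (Suc n)" using x(2) unfolding n_def by linarith+
    have "y \<in> edge n" if y: "y \<in> C" for y
    proof -
      have "y \<noteq> real n" "y \<noteq> real (Suc n)" "x \<noteq> real n" using y x(1) assms(2) by auto
      then show ?thesis
        using avoid[OF x(1) y, of "Suc n"] avoid[OF y x(1), of n] n unfolding edge_def by auto
    qed
    then show False using \<open>\<not> (\<exists>n. C \<subseteq> edge n)\<close> by blast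
  qed
qed

text \<open>Compact intervals stay closed in the coarser Hausdorff topology, so no distant limit
  points arise.\<close>

lemma closure_of_edge_subset: "C \<subseteq> edge n \<Longrightarrow> line X closure_of C \<subseteq> {real n..real (Suc n)}"
  by (rule closure_of_minimal) (auto simp: edge_def intro!: line.closedin_if_compact)

lemma closure_of_edge: "line X closure_of edge n \<inter> \<nat> = {real n, real (Suc n)}"
proof
  show "line X closure_of edge n \<inter> \<nat> \<subseteq> {real n, real (Suc n)}"
    using closure_of_edge_subset[of "edge n" n X] by (auto elim!: Nats_cases)
  have "closure (edge n) = {real n..real (Suc n)}"
    unfolding edge_def by (rule closure_greaterThanLessThan) simp
  then show "{real n, real (Suc n)} \<subseteq> line X closure_of edge n \<inter> \<nat>"
    using line.closure_le_closure_of[of "edge n" X] by auto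
qed

text \<open>A connected set unbounded below contains everything far enough to the left, in
  particular points of every tail.\<close>

lemma closure_of_unbounded_below:
  assumes "connected C" "\<not> bdd_below C" "n > 0"
  shows "real n \<in> line X closure_of C"
  unfolding in_closure_of
proof (intro conjI allI impI)
  fix U assume U: "real n \<in> U \<and> openin (line X) U"
  then obtain A \<epsilon> where A: "A \<in> traces X n" "0 < \<epsilon>" "halo n A \<epsilon> \<subseteq> U"
    using line.halo_subset_open by metis
  then obtain m where m: "A = tail n m" using assms(3) by (auto simp: traces_def)
  obtain c where c: "c \<in> C" using assms(2) by (metis all_not_in_conv bdd_below_empty)
  obtain j :: nat where j: "real j > \<bar>c\<bar>" using reals_Archimedean2 by blast
  \<comment> \<open>The index is at least \<open>m\<close> to stay in the tail and at least
    \<open>j\<close> to lie to the left of \<open>c\<close>.\<close>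
  define d where "d = - real (Suc (prod_encode (n, max m j)))"
  have "real j \<le> real (Suc (prod_encode (n, max m j)))"
    using le_prod_encode_2[of "max m j" n] by linarith
  then have "d < c" unfolding d_def using j by linarith
  moreover obtain b where "b \<in> C" "b < d"
    using assms(2) unfolding bdd_below_def by (meson not_le)
  ultimately have "d \<in> C" using connectedD_interval[OF assms(1) \<open>b \<in> C\<close> c] by simp
  moreover have "d \<in> A" by (auto simp: m tail_def d_def)
  then have "d \<in> halo n A \<epsilon>" using A(2) by (force simp: halo_def)
  ultimately show "\<exists>y. y \<in> C \<and> y \<in> U" using A(3) by blast
qed simp

text \<open>Connected subsets of the negative half-line never have exactly two naturals in their
  closure: at most \<open>0\<close> if bounded below, all positive ones otherwise. Hence edges are
  recognised by their closures.\<close>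

lemma connecting_edge:
  assumes "connectedin (line X) C" "C \<inter> \<nat> = {}"
    and cl: "line X closure_of C \<inter> \<nat> = {real a, real b}" and "a < b"
  shows "b = Suc a \<and> C \<subseteq> edge a"
proof -
  have C: "connected C" using line.connected_if_connectedin assms by blast
  show ?thesis
  proof (cases "\<exists>n. C \<subseteq> edge n")
    case True
    then obtain n where n: "C \<subseteq> edge n" by blast
    have "{real a, real b} \<subseteq> {real n..real (Suc n)}" using closure_of_edge_subset[OF n] cl by blast
    then have "a = n \<and> b = Suc n" using \<open>a < b\<close> by auto
    then show ?thesis using n by simp
  next
    case False
    then have neg: "C \<subseteq> {..<0}" using connected_avoiding_naturals C assms(2) by blast
    have False
    proof (cases "bdd_below C")
      case True
      then obtain l where "\<And>c. c \<in> C \<Longrightarrow> l \<le> c" unfolding bdd_below_def by blast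
      then have "C \<subseteq> {l..0}" using neg by force
      then have "line X closure_of C \<subseteq> {l..0}"
        by (rule closure_of_minimal) (auto intro: line.closedin_if_compact)
      then have "real b \<le> 0" using cl by auto
      then show False using \<open>a < b\<close> by simp
    next
      case False
      then have "{real 1, real 2, real 3} \<subseteq> line X closure_of C \<inter> \<nat>"
        using closure_of_unbounded_below[OF C False, of 1 X] closure_of_unbounded_below[OF C False, of 2 X]
          closure_of_unbounded_below[OF C False, of 3 X] by auto
      then show False unfolding cl by auto
    qed
    then show ?thesis ..
  qed
qed

text \<open>One descending step forces, by injectivity, descent forever, which is impossible. So
  every step ascends, and surjectivity makes the values start at \<open>0\<close>.\<close>

lemma path_automorphism:
  fixes \<pi> :: "nat \<Rightarrow> nat"
  assumes "inj \<pi>" "surj \<pi>" and step: "\<And>n. \<pi> (Suc n) = Suc (\<pi> n) \<or> \<pi> n = Suc (\<pi> (Suc n))"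
  shows "\<pi> n = n"
proof -
  have up: "\<pi> (Suc n) = Suc (\<pi> n)" for n
  proof (rule ccontr)
    assume "\<pi> (Suc n) \<noteq> Suc (\<pi> n)"
    then have down: "\<pi> n = Suc (\<pi> (Suc n))" using step by blast
    have *: "\<pi> (n + k) = Suc (\<pi> (Suc (n + k)))" for k
    proof (induction k)
      case 0
      then show ?case using down by simp
    next
      case (Suc k)
      have "\<pi> (Suc (Suc (n + k))) \<noteq> \<pi> (n + k)" 
        using inj_eq[OF \<open>inj \<pi>\<close>, of "Suc (Suc (n + k))" "n + k"] by simp
      then show ?case using step[of "Suc (n + k)"] Suc by auto
    qed
    have "\<pi> (n + k) + k = \<pi> n" for k
    proof (induction k)
      case (Suc k)
      then show ?case using *[of k] by simp
    qed simp
    from this[of "Suc (\<pi> n)"] show False by simp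
  qed
  have "\<pi> n = \<pi> 0 + n" for n by (induction n) (auto simp: up)
  moreover obtain k where "\<pi> k = 0" using \<open>surj \<pi>\<close> by (metis surjD)
  ultimately show ?thesis by (metis add_0 add_is_0)
qed

text \<open>The natural numbers are exactly the points at which a topology \<open>line X\<close> is not locally
  connected, and the edges make them into a one-sided infinite path, which is rigid.\<close>

lemma homeomorphism_fixes:
  assumes "homeomorphic_maps (line X) (line Y) f g"
  shows "f (real n) = real n" and "f ` edge n \<subseteq> edge n"
proof -
  have f: "homeomorphic_map (line X) (line Y) f"
    using assms homeomorphic_maps_map by blast
  have fg: "f (g y) = y" "g (f y) = y" for y
    using assms by (auto simp: homeomorphic_maps_def)
  \<comment> \<open>Local connectedness at a point is a topological property, so naturals correspond
    to naturals.\<close>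
  have nat_f: "f x \<in> \<nat> \<longleftrightarrow> x \<in> \<nat>" for x
    using locally_connected_at_homeomorphic_maps[OF assms, of x]
      locally_connected_at_homeomorphic_maps[OF homeomorphic_maps_sym[THEN iffD1, OF assms], of "f x"]
    by (auto simp: line.locally_connected_at_glue fg)
  define \<pi> where "\<pi> n = (THE m. f (real n) = real m)" for n
  have \<pi>: "f (real n) = real (\<pi> n)" for n
  proof -
    obtain m where m: "f (real n) = real m" using nat_f[of "real n"] by (auto elim: Nats_cases)
    then show ?thesis unfolding \<pi>_def by (simp add: m)
  qed
  have edge: "connectedin (line Y) (f ` edge n)" "f ` edge n \<inter> \<nat> = {}"
      "line Y closure_of (f ` edge n) \<inter> \<nat> = {real (\<pi> n), real (\<pi> (Suc n))}" for n
  proof -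
    have "connectedin (line X) (edge n)"
      by (rule line.connectedin_if_connected) (simp add: edge_def)
    then show "connectedin (line Y) (f ` edge n)"
      using f by (meson connectedin_continuous_map_image homeomorphic_imp_continuous_map)
    show "f ` edge n \<inter> \<nat> = {}" using edge_naturals[of n] by (auto simp: nat_f disjoint_iff)
    have "line Y closure_of (f ` edge n) = f ` (line X closure_of edge n)"
      using homeomorphic_map_closure_of[OF f] by simp
    then have "line Y closure_of (f ` edge n) \<inter> \<nat> = f ` (line X closure_of edge n \<inter> \<nat>)"
      by (auto simp: nat_f)
    then show "line Y closure_of (f ` edge n) \<inter> \<nat> = {real (\<pi> n), real (\<pi> (Suc n))}"
      by (simp add: closure_of_edge \<pi> del: of_nat_Suc)
  qed
  have inj: "inj \<pi>"
    by (rule injI) (metis \<pi> fg(2) of_nat_eq_iff)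
  have surj: "surj \<pi>"
  proof (rule surjI)
    fix m
    have "g (real m) \<in> \<nat>" using nat_f[of "g (real m)"] fg by simp
    then obtain n where n: "g (real m) = real n" by (auto elim: Nats_cases)
    then show "\<pi> (nat \<lfloor>g (real m)\<rfloor>) = m" using \<pi>[of n] fg(1)[of "real m"] by simp
  qed
  have "\<pi> (Suc n) = Suc (\<pi> n) \<or> \<pi> n = Suc (\<pi> (Suc n))" for n
  proof (cases "\<pi> n < \<pi> (Suc n)")
    case True
    then show ?thesis using connecting_edge[OF edge(1,2,3)[of n]] by simp
  next
    case False
    have "\<pi> n \<noteq> \<pi> (Suc n)" using inj_eq[OF inj, of n "Suc n"] by simp
    \<comment> \<open>In the descending case the end points enter in reverse order.\<close>
    then show ?thesis
      using connecting_edge[OF edge(1,2)[of n], of "\<pi> (Suc n)" "\<pi> n"] edge(3)[of n] False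
      by (simp add: insert_commute)
  qed
  then have id: "\<pi> n = n" for n using path_automorphism[OF inj surj] by blast
  show "f (real n) = real n" using \<pi> id by simp
  show "f ` edge n \<subseteq> edge n"
    using connecting_edge[OF edge(1,2)[of n], of n "Suc n"] edge(3)[of n] id by simp
qed

section \<open>Recovering the set from its topology\<close>

lemma open_halo_comb: "finite R \<Longrightarrow> R \<subseteq> X \<Longrightarrow> openin (line X) (halo 0 (comb m R) (1 / 4))"
  by (intro line.openin_halo comb_in_traces) auto

text \<open>The ball of radius 1/4 around \<open>j + 1 / 2\<close> stays inside
  \<open>edge j\<close>, so only the centre \<open>k + 1 / 2\<close> reaches \<open>edge k\<close>;
  \<open>k > 0\<close> excludes the ball around \<open>0\<close>.\<close>

lemma halo_comb_edge:
  assumes "x \<in> halo 0 (comb m R) (1 / 4)" "x \<in> edge k" "k > 0"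
  shows "R \<subseteq> cov k"
proof -
  obtain d where d: "d \<in> insert 0 (comb m R)" "dist d x < 1 / 4"
    using assms(1) unfolding halo_def UN_iff mem_ball of_nat_0 by blast
  have x: "real k < x" "x < real k + 1" "real k \<ge> 1" using assms(2,3) by (auto simp: edge_def)
  have "d \<noteq> 0" using d(2) x unfolding dist_real_def by linarith
  then obtain j where j: "d = real j + 1 / 2" "R \<subseteq> cov j" using d(1) by (auto simp: comb_def)
  have "j = k" using d(2) x unfolding j dist_real_def by linarith
  then show ?thesis using j by simp
qed

lemma comb_in_open_neighbourhood:
  assumes "openin (line X) U" "0 \<in> U"
  obtains m R where "finite R" "R \<subseteq> X" "comb m R \<subseteq> U"
proof -
  obtain A \<epsilon> where A: "A \<in> traces X 0" "0 < \<epsilon>" "halo 0 A \<epsilon> \<subseteq> U"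
    using line.halo_subset_open[OF assms(1), of 0] assms(2) by (metis of_nat_0)
  then obtain m R where "A = comb m R" "finite R" "R \<subseteq> X" by (auto simp: traces_def)
  moreover have "A \<subseteq> halo 0 A \<epsilon>" using A(2) by (force simp: halo_def)
  ultimately show ?thesis using that A by blast
qed

text \<open>The image of the halo given by \<open>x\<close> is a neighbourhood of \<open>0\<close>,
  hence contains a comb from \<open>Y\<close>. Since homeomorphisms preserve edges, this comb can be
  compared with the halo edge by edge, and independence forces \<open>x\<close> into
  \<open>Y\<close>.\<close>

lemma homeomorphic_maps_imp_subset:
  assumes "homeomorphic_maps (line X) (line Y) f g"
  shows "X \<subseteq> Y"
proof
  fix x assume "x \<in> X"
  let ?U = "halo 0 (comb 0 {x}) (1 / 4)"
  have fg: "f (g y) = y" "g (f y) = y" for y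
    using assms by (auto simp: homeomorphic_maps_def)
  have "openin (line X) ?U" using \<open>x \<in> X\<close> by (intro open_halo_comb) auto
  moreover have "homeomorphic_map (line X) (line Y) f"
    using assms homeomorphic_maps_map by blast
  ultimately have "openin (line Y) (f ` ?U)" using homeomorphic_map_openness_eq by blast
  moreover have "0 \<in> f ` ?U"
    using homeomorphism_fixes(1)[OF assms, of 0] line.in_halo[of "1 / 4" 0] by force
  ultimately obtain m R where R: "finite R" "R \<subseteq> Y" "comb m R \<subseteq> f ` ?U"
    by (rule comb_in_open_neighbourhood)
  show "x \<in> Y"
  proof (rule ccontr)
    assume "x \<notin> Y"
    then have "x \<notin> R" using R by blast
    \<comment> \<open>\<open>Suc m\<close> in place of \<open>m\<close> also guarantees
      \<open>k > 0\<close>, as \<open>halo_comb_edge\<close> requires.\<close>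
    then obtain k where k: "k \<ge> Suc m" "R \<subseteq> cov k" "x \<notin> cov k"
      using cov_independent[OF R(1)] by blast
    have "real k + 1 / 2 \<in> comb m R" using k by (auto simp: comb_def)
    then have "real k + 1 / 2 \<in> f ` ?U" by (rule subsetD[OF R(3)])
    then obtain y where y: "real k + 1 / 2 = f y" "y \<in> ?U" by (rule imageE)
    have "real k + 1 / 2 \<in> edge k" by (auto simp: edge_def)
    then have "g (real k + 1 / 2) \<in> edge k"
      using homeomorphism_fixes(2)[OF homeomorphic_maps_sym[THEN iffD1, OF assms], of k] by blast
    then have "y \<in> edge k" by (simp add: y(1) fg)
    then show False using halo_comb_edge[OF y(2), of k] k by auto
  qed
qed

lemma homeomorphic_line_iff: "line X homeomorphic_space line Y \<longleftrightarrow> X = Y"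
  using homeomorphic_maps_imp_subset homeomorphic_maps_sym homeomorphic_space_refl
  unfolding homeomorphic_space_def by (metis subset_antisym)

section \<open>Weight\<close>

lemma lepoll_iff_card_of: "A \<lesssim> B \<longleftrightarrow> (card_of A, card_of B) \<in> ordLeq"
  by (simp add: lepoll_def card_of_ordLeq)

lemma Un_lepoll_infinite:
  assumes "infinite X" "A \<lesssim> X" "B \<lesssim> X"
  shows "A \<union> B \<lesssim> X"
  using assms unfolding lepoll_iff_card_of
  by (intro card_of_Un_ordLeq_infinite_Field) (auto simp: Field_card_of card_of_card_order_on)

lemma Times_lepoll_infinite:
  assumes "infinite X" "A \<lesssim> X" "B \<lesssim> X"
  shows "A \<times> B \<lesssim> X"
  using assms unfolding lepoll_iff_card_of
  by (intro card_of_Times_ordLeq_infinite_Field) (auto simp: Field_card_of card_of_card_order_on)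

lemma UN_lepoll_infinite:
  assumes "infinite X" "I \<lesssim> X" "\<And>i. i \<in> I \<Longrightarrow> A i \<lesssim> X"
  shows "(\<Union>i\<in>I. A i) \<lesssim> X"
  using assms unfolding lepoll_iff_card_of by (intro card_of_UNION_ordLeq_infinite) auto

lemma countable_lepoll_infinite:
  assumes "countable A" "infinite X"
  shows "A \<lesssim> X"
proof -
  have "A \<lesssim> (UNIV :: nat set)" using assms(1) by (auto simp: countable_def lepoll_def)
  then show ?thesis using assms(2) infinite_le_lepoll lepoll_trans by blast
qed

text \<open>Induction on the size: a set with \<open>n + 1\<close> elements arises from a point and
  a set with \<open>n\<close> elements.\<close>

lemma finite_subsets_lepoll:
  assumes "infinite X"
  shows "{R. finite R \<and> R \<subseteq> X} \<lesssim> X"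
proof -
  define F where "F n = {R. finite R \<and> R \<subseteq> X \<and> card R = n}" for n
  have "F n \<lesssim> X" for n
  proof (induction n)
    case 0
    have "F 0 = {{}}" by (auto simp: F_def)
    then show ?case using finite_lepoll_infinite[OF assms, of "{{}}"] by simp
  next
    case (Suc n)
    have "F (Suc n) \<subseteq> (\<lambda>(x, R). insert x R) ` (X \<times> F n)"
    proof
      fix R assume "R \<in> F (Suc n)"
      then obtain x Q where "R = insert x Q" "x \<notin> Q" "card Q = n" "finite Q" "R \<subseteq> X"
        unfolding F_def by (auto simp: card_Suc_eq_finite)
      then show "R \<in> (\<lambda>(x, R). insert x R) ` (X \<times> F n)" by (auto simp: F_def)
    qed
    then have "F (Suc n) \<lesssim> X \<times> F n" by (rule subset_image_lepoll)
    also have "X \<times> F n \<lesssim> X" using Times_lepoll_infinite[OF assms lepoll_refl Suc] .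
    finally show ?case .
  qed
  then have "(\<Union>n\<in>UNIV. F n) \<lesssim> X"
    using assms infinite_le_lepoll by (intro UN_lepoll_infinite) auto
  moreover have "(\<Union>n\<in>UNIV. F n) = {R. finite R \<and> R \<subseteq> X}" by (auto simp: F_def)
  ultimately show ?thesis by simp
qed

text \<open>\<open>B\<close> must be infinite, and then \<open>B\<close> many finite sets cover at
  most \<open>B\<close> many points.\<close>

lemma lepoll_if_finite_fibres:
  assumes "infinite X" "X \<subseteq> (\<Union>b\<in>B. F b)" "\<And>b. b \<in> B \<Longrightarrow> finite (F b)"
  shows "X \<lesssim> B"
proof -
  have "infinite B" using assms finite_subset by blast
  then have "(\<Union>b\<in>B. F b) \<lesssim> B"
    using assms(3) finite_lepoll_infinite by (intro UN_lepoll_infinite) auto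
  then show ?thesis using assms(2) subset_imp_lepoll lepoll_trans by blast
qed

text \<open>An open \<open>b\<close> around \<open>0\<close> contains a comb of some finite
  \<open>R\<close>; by independence it fits into the halo of \<open>x\<close> only for
  \<open>x \<in> R\<close>. So each basic set serves finitely many \<open>x\<close>.\<close>

lemma lepoll_base_of_line:
  assumes "infinite X" "base_of (line X) B"
  shows "X \<lesssim> B"
proof (rule lepoll_if_finite_fibres[OF assms(1)])
  define F where "F b = {x \<in> X. 0 \<in> b \<and> b \<subseteq> halo 0 (comb 0 {x}) (1 / 4)}" for b
  show "X \<subseteq> (\<Union>b\<in>B. F b)"
  proof
    fix x assume x: "x \<in> X"
    then have "openin (line X) (halo 0 (comb 0 {x}) (1 / 4))" by (intro open_halo_comb) auto
    moreover have "0 \<in> halo 0 (comb 0 {x}) (1 / 4)" using line.in_halo[of "1 / 4" 0] by simp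
    ultimately obtain b where "b \<in> B" "0 \<in> b" "b \<subseteq> halo 0 (comb 0 {x}) (1 / 4)"
      using assms(2) unfolding base_of_def by meson
    then show "x \<in> (\<Union>b\<in>B. F b)" using x by (auto simp: F_def)
  qed
  fix b assume "b \<in> B"
  then have b: "openin (line X) b" using assms(2) by (auto simp: base_of_def)
  show "finite (F b)"
  proof (cases "0 \<in> b")
    case True
    obtain m R where R: "finite R" "R \<subseteq> X" "comb m R \<subseteq> b"
      using comb_in_open_neighbourhood[OF b True] .
    have "F b \<subseteq> R"
    proof (rule subsetI, rule ccontr)
      fix x assume x: "x \<in> F b" "x \<notin> R"
      then obtain k where k: "k \<ge> Suc m" "R \<subseteq> cov k" "x \<notin> cov k"
        using cov_independent[OF R(1)] by blast
      have "real k + 1 / 2 \<in> comb m R" using k by (auto simp: comb_def)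
      then have "real k + 1 / 2 \<in> halo 0 (comb 0 {x}) (1 / 4)" using R(3) x(1) by (auto simp: F_def)
      moreover have "real k + 1 / 2 \<in> edge k" by (auto simp: edge_def)
      ultimately show False using halo_comb_edge[of _ 0 "{x}" k] k by auto
    qed
    then show ?thesis using R(1) finite_subset by blast
  qed (simp add: F_def)
qed

lemma exists_small_base_of_line:
  assumes "infinite X"
  shows "\<exists>B. base_of (line X) B \<and> B \<lesssim> X"
proof (intro exI conjI)
  \<comment> \<open>Countably many rational intervals take care of the points outside the
    naturals.\<close>
  define J where "J = (\<lambda>(a, b). {real_of_rat a<..<real_of_rat b}) ` UNIV \<inter> {V. V \<inter> \<nat> = {}}"
  \<comment> \<open>Radii \<open>1 / (k + 2)\<close> tend to zero and respect the bound 1/2 of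
    \<open>openin_halo\<close>.\<close>
  define h where "h = (\<lambda>((n, m, k), R). halo n (if n = 0 then comb m R else tail n m) (1 / real (k + 2)))"
  \<comment> \<open>Countable data together with the finite subsets of \<open>X\<close> index all
    halos, whence the cardinality bound.\<close>
  define H where "H = h ` (UNIV \<times> {R. finite R \<and> R \<subseteq> X})"
  have h_trace: "\<exists>A\<in>traces X n. h ((n, m, k), R) = halo n A (1 / real (k + 2))"
    if "finite R" "R \<subseteq> X" for n m k R
    using that comb_in_traces by (auto simp: h_def traces_def)
  have trace_h: "halo n A (1 / real (k + 2)) \<in> H" if A: "A \<in> traces X n" for n A k
  proof (cases "n = 0")
    case True
    then obtain m R where "A = comb m R" "finite R" "R \<subseteq> X" using A True by (auto simp: traces_def)
    then show ?thesis using True unfolding H_def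
      by (intro image_eqI[of _ _ "((n, m, k), R)"]) (auto simp: h_def)
  next
    case False
    then obtain m where "A = tail n m" using A False by (auto simp: traces_def)
    then show ?thesis using False unfolding H_def
      by (intro image_eqI[of _ _ "((n, m, k), {})"]) (auto simp: h_def)
  qed
  show "base_of (line X) (J \<union> H)"
    unfolding base_of_def
  proof (intro conjI ballI allI impI)
    fix V assume "V \<in> J \<union> H"
    then show "openin (line X) V"
    proof
      assume "V \<in> J"
      then show ?thesis by (intro line.openin_if_no_naturals) (auto simp: J_def)
    next
      assume "V \<in> H"
      then obtain n m k R where V: "V = h ((n, m, k), R)" "finite R" "R \<subseteq> X" by (auto simp: H_def)
      then obtain A where A: "A \<in> traces X n" "V = halo n A (1 / real (k + 2))"
        using h_trace by metis
      have "0 < 1 / real (k + 2)" "1 / real (k + 2) \<le> 1 / 2" by (auto simp: field_simps)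
      then show ?thesis unfolding A(2) by (rule line.openin_halo[OF A(1)])
    qed
  next
    fix U x assume U: "openin (line X) U \<and> x \<in> U"
    show "\<exists>V\<in>J \<union> H. x \<in> V \<and> V \<subseteq> U"
    proof (cases "x \<in> \<nat>")
      case True
      then obtain n where n: "x = real n" by (auto elim: Nats_cases)
      then obtain A \<epsilon> where A: "A \<in> traces X n" "0 < \<epsilon>" "halo n A \<epsilon> \<subseteq> U"
        using U line.halo_subset_open by metis
      obtain k where "inverse (real (Suc k)) < \<epsilon>" using reals_Archimedean[OF A(2)] by blast
      moreover have "1 / real (k + 2) \<le> inverse (real (Suc k))" by (simp add: field_simps)
      ultimately have "halo n A (1 / real (k + 2)) \<subseteq> halo n A \<epsilon>"
        by (intro line.halo_mono) auto
      then show ?thesis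
        using trace_h[OF A(1), of k] A(3) n line.in_halo[of "1 / real (k + 2)" n A]
        by (intro bexI[of _ "halo n A (1 / real (k + 2))"]) auto
    next
      case False
      have "open (U - \<nat>)" using U by (intro open_Diff line.openin_imp_open) auto
      then obtain \<epsilon> where e: "\<epsilon> > 0" "ball x \<epsilon> \<subseteq> U - \<nat>"
        using U False open_contains_ball by blast
      obtain a b where ab: "x - \<epsilon> < real_of_rat a" "real_of_rat a < x"
          "x < real_of_rat b" "real_of_rat b < x + \<epsilon>"
        using of_rat_dense[of "x - \<epsilon>" x] of_rat_dense[of x "x + \<epsilon>"] e(1) by auto
      let ?V = "{real_of_rat a<..<real_of_rat b}"
      have "?V \<subseteq> ball x \<epsilon>" using ab by (auto simp: dist_real_def)
      then have "?V \<subseteq> U" "?V \<in> J" using e(2) by (auto simp: J_def)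
      then show ?thesis using ab by (intro bexI[of _ ?V]) auto
    qed
  qed
  have "countable J" by (auto simp: J_def)
  then have "J \<lesssim> X" using assms by (rule countable_lepoll_infinite)
  moreover have "H \<lesssim> X"
  proof -
    have "H \<lesssim> (UNIV :: (nat \<times> nat \<times> nat) set) \<times> {R. finite R \<and> R \<subseteq> X}"
      unfolding H_def by (rule image_lepoll)
    also have "\<dots> \<lesssim> X"
      using assms by (intro Times_lepoll_infinite finite_subsets_lepoll countable_lepoll_infinite) auto
    finally show ?thesis .
  qed
  ultimately show "J \<union> H \<lesssim> X"
    using assms by (intro Un_lepoll_infinite)
qed

lemma has_weight_line:
  assumes "X \<approx> K" "infinite K"
  shows "has_weight (line X) K"
  unfolding has_weight_def
proof (intro conjI allI impI)
  have X: "infinite X" using assms by (simp add: eqpoll_finite_iff)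
  have lower: "K \<lesssim> B" if "base_of (line X) B" for B
    using lepoll_base_of_line[OF X that] assms(1) by (meson eqpoll_imp_lepoll eqpoll_sym lepoll_trans)
  then show "(card_of K, card_of B) \<in> ordLeq" if "base_of (line X) B" for B
    using that by (simp add: lepoll_iff_card_of)
  obtain B where B: "base_of (line X) B" "B \<lesssim> X"
    using exists_small_base_of_line[OF X] by blast
  then have "B \<approx> K"
    using lower assms(1) by (meson eqpoll_imp_lepoll lepoll_antisym lepoll_trans)
  then show "\<exists>B. base_of (line X) B \<and> (card_of B, card_of K) \<in> ordIso"
    using B(1) eqpoll_iff_card_of_ordIso by blast
qed

section \<open>The family of pairwise non-homeomorphic topologies\<close>

text \<open>Infinite sets \<open>K\<close> of reals represent the infinite cardinals up to the
  continuum.\<close>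

theorem theorem10:
  fixes K :: "real set"
  assumes "infinite K"
  shows "\<exists>\<T> :: real topology set.
           \<T> \<subseteq> L_family \<and>
           (card_of \<T>, card_of (Pow K)) \<in> ordIso \<and>
           (\<forall>\<tau>\<in>\<T>. hereditarily normal_space \<tau> \<and> Baire_space \<tau> \<and> has_weight \<tau> K) \<and>
           (\<forall>\<tau>\<in>\<T>. \<forall>\<tau>'\<in>\<T>. \<tau> \<noteq> \<tau>' \<longrightarrow> \<not> (\<tau> homeomorphic_space \<tau>'))"
proof -
  \<comment> \<open>The positive copy of \<open>K\<close> fixes the cardinality of
    \<open>\<phi> S\<close>, and the negative part codes \<open>S\<close>; this gives
    \<open>2^|K|\<close> index sets of the same size.\<close>
  define \<phi> where "\<phi> S = exp ` K \<union> (\<lambda>x. - exp x) ` S" for S :: "real set"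
  have \<phi>: "\<phi> S \<approx> K" if "S \<subseteq> K" for S
  proof (rule lepoll_antisym)
    have "(\<lambda>x. - exp x) ` S \<lesssim> K"
      using image_lepoll subset_imp_lepoll[OF that] lepoll_trans by blast
    then show "\<phi> S \<lesssim> K"
      unfolding \<phi>_def using assms image_lepoll Un_lepoll_infinite by blast
    have "K \<approx> exp ` K" using inj_on_image_eqpoll_2[of exp K] by (simp add: inj_on_def)
    then show "K \<lesssim> \<phi> S"
      unfolding \<phi>_def by (meson Un_upper1 eqpoll_imp_lepoll lepoll_trans subset_imp_lepoll)
  qed
  have "S = {x. - exp x \<in> \<phi> S}" if "S \<subseteq> K" for S
  proof -
    have "- exp x \<noteq> exp y" for x y :: real
      using exp_gt_zero[of x] exp_gt_zero[of y] by linarith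
    then show ?thesis by (auto simp: \<phi>_def)
  qed
  then have inj_\<phi>: "inj_on \<phi> (Pow K)" by (metis PowD inj_onI)
  let ?\<T> = "(\<lambda>S. line (\<phi> S)) ` Pow K"
  have inj: "inj_on (\<lambda>S. line (\<phi> S)) (Pow K)"
  proof (rule inj_onI)
    fix S S' assume S: "S \<in> Pow K" "S' \<in> Pow K" and "line (\<phi> S) = line (\<phi> S')"
    \<comment> \<open>Equal topologies are homeomorphic, so the classification up to homeomorphism
      also yields the cardinality of the family.\<close>
    then have "\<phi> S = \<phi> S'" using homeomorphic_line_iff homeomorphic_space_refl by metis
    then show "S = S'" using inj_onD[OF inj_\<phi>] S by blast
  qed
  show ?thesis
  proof (intro exI conjI ballI impI)
    show "?\<T> \<subseteq> L_family" using line_in_L_family by blast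
    show "(card_of ?\<T>, card_of (Pow K)) \<in> ordIso"
      using inj inj_on_image_eqpoll_1 eqpoll_iff_card_of_ordIso by blast
  next
    fix \<tau> assume "\<tau> \<in> ?\<T>"
    then obtain S where S: "\<tau> = line (\<phi> S)" "S \<subseteq> K" by blast
    show "hereditarily normal_space \<tau>" "Baire_space \<tau>"
      unfolding S(1) by (rule line.hereditarily_normal_glue, rule line.Baire_glue)
    show "has_weight \<tau> K" unfolding S(1) using has_weight_line[OF \<phi>[OF S(2)] assms] .
  next
    fix \<tau> \<tau>' assume "\<tau> \<in> ?\<T>" "\<tau>' \<in> ?\<T>" "\<tau> \<noteq> \<tau>'"
    then show "\<not> \<tau> homeomorphic_space \<tau>'" using homeomorphic_line_iff by auto
  qed
qed

end
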